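(* Let $\Omega=\{(\zeta,t)\in\mathbb{H}_n:t>0\}$, let $\beta=(\zeta',t')\in\Omega$ and let $\beta^*=(\zeta',-t')$ be its reflection with respect to $\partial\Omega$. Then, for $\alpha\neq\beta$, $$G(\beta,\alpha)=\bar g_\beta(\alpha)+\bar g_{\beta^*}(\alpha)$$ acts as the Neumann function for the pair $(\Delta_0,\Omega)$ when applied to circular functions; that is (all derivatives being with respect to $\alpha$), $\Delta_0G(\beta,\cdot)=\delta_\beta$ in $\Omega$ when tested against circular functions, and $\partial^\perp G(\beta,\cdot)=0$ on $\partial\Omega$.
   Context: The Heisenberg group $\mathbb{H}_n$ is $\mathbb{C}^n\times\mathbb{R}$ with the group law $(\zeta,t)(\eta,s)=(\zeta+\eta,\ t+s+2\,\mathrm{Im}(\zeta\cdot\bar\eta))$, where $\zeta\cdot\bar\eta=\sum_j\zeta_j\bar\eta_j$. Write $\zeta_j=x_j+i y_j$ and $X_j=\partial_{x_j}+2y_j\partial_t$, $Y_j=\partial_{y_j}-2x_j\partial_t$, $Z_j=\frac12(X_j-iY_j)$, $\bar Z_j=\frac12(X_j+iY_j)$. Set $\Delta_0=\frac14\sum_{j=1}^n(X_j^2+Y_j^2)$ (that is, $\Delta_0=-\frac14\Delta_{\mathbb{H}_n}$ with $\Delta_{\mathbb{H}_n}=-\sum_j(X_j^2+Y_j^2)$ the Kohn-Laplacian). For $\alpha=(\zeta,t)$, $\beta=(\zeta',t')$ put $C(\beta,\alpha)=|\zeta|^2+|\zeta'|^2+i(t'-t)$, $Q(\beta,\alpha)=2\zeta\cdot\bar\zeta'$,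 and $g_\beta(\alpha)=a_0|C(\beta,\alpha)-Q(\beta,\alpha)|^{-n}$, where $a_0$ is the real constant for which $\Delta_0g_\beta=\delta_\beta$ on $\mathbb{H}_n$. The average of a function $f$ is $\bar f(\zeta,t)=\frac1{2\pi}\int_0^{2\pi}f(e^{i\theta}\zeta,t)\,d\theta$, and $f$ is called circular if $f=\bar f$; $\bar g_\beta$ is the average of $g_\beta$ in the variable $\alpha$. The Neumann function for $(\Delta_0,\Omega)$ is a function $G$ with $\Delta_0G(\beta,\alpha)=\delta_\beta$ in $\Omega$ and $\partial^\perp G(\beta,\alpha)=0$ on $\partial\Omega$. For the half-space $\Omega$, the outward horizontal unit normal is, at points with $\zeta\neq0$, $\frac{\partial}{\partial n_0}=i\,\frac{E-\bar E}{|\zeta|}$ with $E=\sum_{j=1}^n\zeta_jZ_j$, i.e. $\frac{\partial}{\partial n_0}=\frac1{|\zeta|}\sum_{j=1}^n(x_jY_j-y_jX_j)$. The boundary points with $\zeta=0$ are called characteristic points. For $\alpha_0\in\partial\Omega$, $\partial^\perp f(\alpha_0)=\frac{\partial f}{\partial n_0}(\alpha_0)$ if $\alpha_0$ is non-characteristic, and $\partial^\perp f(\alpha_0)=\lim_{\alpha\to\alpha_0}\frac{\partial f}{\partial n_0}(\alpha)$ if $\alpha_0$ is characteristic. *)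

theory Defs
  imports "HOL-Analysis.Analysis"
begin

text \<open>
  Points of the Heisenberg group \<open>\<complex>^n \<times> \<real>\<close>, with \<open>n = CARD('n) \<ge> 1\<close>. The norm on \<open>complex ^ 'n\<close>
  is the Euclidean one, and \<open>lborel\<close> on this type is Lebesgue measure, the Haar measure with
  respect to which functions act as distributions.
\<close>
type_synonym 'n heis = "(complex ^ 'n) \<times> real"

definition herm :: "complex ^ 'n \<Rightarrow> complex ^ 'n \<Rightarrow> complex" where
  "herm \<zeta> \<eta> = (\<Sum>j\<in>UNIV. \<zeta> $ j * cnj (\<eta> $ j))"

definition dir_deriv :: "'a::real_normed_vector \<Rightarrow> ('a \<Rightarrow> 'b::real_normed_vector) \<Rightarrow> 'a \<Rightarrow> 'b" where
  "dir_deriv v f p = vector_derivative (\<lambda>s. f (p + s *\<^sub>R v)) (at 0)"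

definition vf_X :: "'n::finite \<Rightarrow> ('n heis \<Rightarrow> 'b::real_normed_vector) \<Rightarrow> 'n heis \<Rightarrow> 'b" where
  "vf_X j f \<alpha> = dir_deriv (axis j 1, 0) f \<alpha> + (2 * Im (fst \<alpha> $ j)) *\<^sub>R dir_deriv (0, 1) f \<alpha>"

definition vf_Y :: "'n::finite \<Rightarrow> ('n heis \<Rightarrow> 'b::real_normed_vector) \<Rightarrow> 'n heis \<Rightarrow> 'b" where
  "vf_Y j f \<alpha> = dir_deriv (axis j \<i>, 0) f \<alpha> - (2 * Re (fst \<alpha> $ j)) *\<^sub>R dir_deriv (0, 1) f \<alpha>"

definition Delta0 :: "('n::finite heis \<Rightarrow> 'b::real_normed_vector) \<Rightarrow> 'n heis \<Rightarrow> 'b" where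
  "Delta0 f \<alpha> = (1 / 4) *\<^sub>R (\<Sum>j\<in>UNIV. vf_X j (vf_X j f) \<alpha> + vf_Y j (vf_Y j f) \<alpha>)"

text \<open>
  \<open>C\<^sup>\<infinity>\<close> on the whole space: all iterated partial derivatives exist and are Frechet differentiable
  (hence continuous).
\<close>
definition smooth_fun :: "('a::euclidean_space \<Rightarrow> 'b::real_normed_vector) \<Rightarrow> bool" where
  "smooth_fun f \<longleftrightarrow>
     (\<forall>vs p. set vs \<subseteq> Basis \<longrightarrow> foldr dir_deriv vs f differentiable (at p))"

text \<open>Elements of \<open>C\<^sub>c\<^sup>\<infinity>(U)\<close>, extended by \<open>0\<close> to the whole space.\<close>
definition test_function :: "'a::euclidean_space set \<Rightarrow> ('a \<Rightarrow> complex) \<Rightarrow> bool" where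
  "test_function U \<phi> \<longleftrightarrow>
     smooth_fun \<phi> \<and> compact (closure {p. \<phi> p \<noteq> 0}) \<and> closure {p. \<phi> p \<noteq> 0} \<subseteq> U"

text \<open>
  The equation \<open>\<Delta>\<^sub>0 u = \<delta>\<^sub>\<beta>\<close> in the open set \<open>U\<close> in the sense of distributions, tested against the
  test functions in the class \<open>P\<close>. No sign appears because \<open>\<Delta>\<^sub>0\<close> is formally self-adjoint.
  Local integrability makes \<open>u\<close> a distribution; the values of \<open>u\<close> on a null set are irrelevant.
\<close>
definition Delta0_eq_delta ::
  "'n::finite heis set \<Rightarrow> (('n heis \<Rightarrow> complex) \<Rightarrow> bool) \<Rightarrow> ('n heis \<Rightarrow> real) \<Rightarrow> 'n heis \<Rightarrow> bool" where
  "Delta0_eq_delta U P u \<beta> \<longleftrightarrow>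
     (\<forall>K. compact K \<and> K \<subseteq> U \<longrightarrow> set_integrable lborel K u) \<and>
     (\<forall>\<phi>. test_function U \<phi> \<and> P \<phi> \<longrightarrow> (LINT \<alpha>|lborel. u \<alpha> *\<^sub>R Delta0 \<phi> \<alpha>) = \<phi> \<beta>)"

definition kernel_C :: "'n::finite heis \<Rightarrow> 'n heis \<Rightarrow> complex" where
  "kernel_C \<beta> \<alpha> = of_real ((norm (fst \<alpha>))\<^sup>2 + (norm (fst \<beta>))\<^sup>2) + \<i> * of_real (snd \<beta> - snd \<alpha>)"

definition kernel_Q :: "'n::finite heis \<Rightarrow> 'n heis \<Rightarrow> complex" where
  "kernel_Q \<beta> \<alpha> = 2 * herm (fst \<alpha>) (fst \<beta>)"

definition g_kernel :: "real \<Rightarrow> 'n::finite heis \<Rightarrow> 'n heis \<Rightarrow> real" where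
  "g_kernel a\<^sub>0 \<beta> \<alpha> = a\<^sub>0 / norm (kernel_C \<beta> \<alpha> - kernel_Q \<beta> \<alpha>) ^ CARD('n)"

text \<open>
  \<open>a\<^sub>0\<close> is the normalizing constant of the fundamental solution: \<open>\<Delta>\<^sub>0 g\<^sub>\<beta> = \<delta>\<^sub>\<beta>\<close> on the whole group,
  for every pole \<open>\<beta>\<close>.
\<close>
definition normalizing_constant :: "'n::finite itself \<Rightarrow> real \<Rightarrow> bool" where
  "normalizing_constant _ a\<^sub>0 \<longleftrightarrow>
     (\<forall>\<beta> :: 'n heis. Delta0_eq_delta UNIV (\<lambda>_. True) (g_kernel a\<^sub>0 \<beta>) \<beta>)"

definition circ_average ::
  "('n::finite heis \<Rightarrow> 'b::{banach, second_countable_topology}) \<Rightarrow> 'n heis \<Rightarrow> 'b" where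
  "circ_average f \<alpha> =
     (1 / (2 * pi)) *\<^sub>R (LINT \<theta>:{0..2 * pi}|lborel. f (cis \<theta> *s fst \<alpha>, snd \<alpha>))"

definition circular :: "('n::finite heis \<Rightarrow> 'b::{banach, second_countable_topology}) \<Rightarrow> bool" where
  "circular f \<longleftrightarrow> f = circ_average f"

definition half_space :: "'n::finite heis set" where
  "half_space = {\<alpha>. snd \<alpha> > 0}"

definition reflect :: "'n::finite heis \<Rightarrow> 'n heis" where
  "reflect \<beta> = (fst \<beta>, - snd \<beta>)"

text \<open>
  The average is in the variable \<open>\<alpha>\<close>. On the circle \<open>{(e\<^sup>i\<^sup>\<theta>\<zeta>', t')}\<close> through \<open>\<beta>\<close> (a null set inside
  the half-space) the averaging integral diverges and takes the value \<open>0\<close> by convention.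
\<close>
definition neumann_G :: "real \<Rightarrow> 'n::finite heis \<Rightarrow> 'n heis \<Rightarrow> real" where
  "neumann_G a\<^sub>0 \<beta> \<alpha> =
     circ_average (g_kernel a\<^sub>0 \<beta>) \<alpha> + circ_average (g_kernel a\<^sub>0 (reflect \<beta>)) \<alpha>"

text \<open>
  Derivative along the outward horizontal unit normal \<open>i (E - E\<^sup>-) / |\<zeta>|\<close> of the half-space, where \<open>E = \<Sum>\<^sub>j \<zeta>\<^sub>j Z\<^sub>j\<close>,
  \<open>Z\<^sub>j = (X\<^sub>j - i Y\<^sub>j) / 2\<close> and \<open>E\<^sup>-\<close> is the conjugate field, written with the real fields; meaningful for
  \<open>fst \<alpha> \<noteq> 0\<close>, on the boundary as well as near it.
\<close>
definition normal_deriv :: "('n::finite heis \<Rightarrow> 'b::real_normed_vector) \<Rightarrow> 'n heis \<Rightarrow> 'b" where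
  "normal_deriv f \<alpha> = (1 / norm (fst \<alpha>)) *\<^sub>R
     (\<Sum>j\<in>UNIV. Re (fst \<alpha> $ j) *\<^sub>R vf_Y j f \<alpha> - Im (fst \<alpha> $ j) *\<^sub>R vf_X j f \<alpha>)"

text \<open>
  \<open>\<partial>\<^sup>\<bottom> f (\<alpha>) = d\<close> at a boundary point \<open>\<alpha>\<close>, including existence of the derivatives involved. At a
  characteristic point the limit is over the points of the closed half-space at which the
  normal is defined.
\<close>
definition has_perp_deriv ::
  "('n::finite heis \<Rightarrow> 'b::real_normed_vector) \<Rightarrow> 'b \<Rightarrow> 'n heis \<Rightarrow> bool" where
  "has_perp_deriv f d \<alpha> \<longleftrightarrow>
     (if fst \<alpha> \<noteq> 0 then f differentiable (at \<alpha>) \<and> normal_deriv f \<alpha> = d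
      else let F = at \<alpha> within {\<alpha>' \<in> closure half_space. fst \<alpha>' \<noteq> 0} in
        (\<forall>\<^sub>F \<alpha>' in F. f differentiable (at \<alpha>')) \<and> (normal_deriv f \<longlongrightarrow> d) F)"

end

theory Submission
  imports Defs
begin

text \<open>
  Write \<open>R\<^sub>\<theta>(\<zeta>, t) = (e\<^sup>i\<^sup>\<theta>\<zeta>, t)\<close>. Since \<open>g\<^sub>\<beta> \<circ> R\<^sub>\<theta>\<close> is \<open>g\<close> with pole \<open>R\<^sub>-\<^sub>\<theta> \<beta>\<close>, Fubini and
  the fundamental solution property at all these poles show that pairing the average of \<open>g\<^sub>\<beta>\<close> with
  \<open>\<Delta>\<^sub>0 \<phi>\<close> gives the average of \<open>\<phi>\<close> at \<open>\<beta>\<close>; this is \<open>\<phi>(\<beta>)\<close> for circular \<open>\<phi>\<close>, and \<open>0\<close> for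
  the reflected pole when \<open>\<phi>\<close> is supported in the half-space.

  For the boundary condition, \<open>|\<zeta>| \<partial>/\<partial>n\<^sub>0\<close> is the generator of the rotations \<open>R\<^sub>\<theta>\<close> minus
  \<open>2|\<zeta>|\<^sup>2 \<partial>\<^sub>t\<close>. The rotational part annihilates \<open>G\<close>. The average of \<open>g\<^sub>\<beta>\<close> is an integral of
  \<open>|C - 2 e\<^sup>i\<^sup>\<theta> w|\<^sup>-\<^sup>n\<close> over \<open>\<theta>\<close>, which depends on \<open>w = \<zeta> \<cdot> \<zeta>'\<^sup>-\<close> only through \<open>|w|\<close>, hence is
  invariant under conjugating \<open>C\<close>; so \<open>G\<close> is even in \<open>t\<close> and \<open>\<partial>\<^sub>t G = 0\<close> at \<open>t = 0\<close>. Near a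
  characteristic point \<open>\<partial>\<^sub>t G\<close> is continuous and the normal derivative is \<open>-2|\<zeta>| \<partial>\<^sub>t G\<close>.
\<close>

section \<open>Isometries and Lebesgue measure\<close>

text \<open>
  Uniqueness of Haar measure: the image measure is translation invariant, so evaluating the integral of
  \<open>1\<^sub>A(y) 1\<^sub>B(y - x)\<close>, with \<open>B\<close> the unit ball, in both orders gives \<open>\<mu>(A) \<lambda>(B) = \<lambda>(A) \<mu>(B)\<close>.
\<close>
lemma lborel_distr_isometry:
  fixes f :: "'a::euclidean_space \<Rightarrow> 'a"
  assumes "linear f" and isom: "\<And>x. norm (f x) = norm x"
  shows "distr lborel borel f = lborel"
proof (rule measure_eqI)
  interpret linear f by fact
  have inj: "inj f"
    using isom by (metis injI diff norm_eq_zero eq_iff_diff_eq_0)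
  have surj: "surj f"
    using \<open>linear f\<close> inj by (rule linear_injective_imp_surjective) simp
  have f[measurable]: "f \<in> borel_measurable borel"
    by (intro borel_measurable_continuous_onI linear_continuous_on)
       (simp add: \<open>linear f\<close> linear_conv_bounded_linear[symmetric])
  let ?\<mu> = "distr lborel borel f"
  let ?B = "ball (0::'a) 1"
  have vimage_ball: "f -` ball (f z) 1 = ball z 1" for z
    using isom by (auto simp: dist_norm simp flip: diff)
  have \<mu>_ball: "emeasure ?\<mu> (ball y 1) = emeasure lborel ?B" for y
  proof -
    obtain z where "y = f z" using surj by blast
    then show ?thesis by (simp add: emeasure_distr vimage_ball emeasure_ball)
  qed
  \<comment> \<open>Writing the translation vector as \<open>f z\<close> turns translation by it
    into translation by \<open>z\<close> in the domain, where Lebesgue measure is invariant.\<close>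
  have \<mu>_translate: "emeasure ?\<mu> ((\<lambda>u. x + u) -` A) = emeasure ?\<mu> A" if "A \<in> sets borel" for x A
  proof -
    obtain z where z: "x = f z" using surj by blast
    have m: "(+) z \<in> borel_measurable borel" "(+) x \<in> borel_measurable borel" by measurable
    have 1: "(+) x -` A \<in> sets borel" using measurable_sets[OF m(2) that] by simp
    have 2: "f -` A \<in> sets borel" using measurable_sets[OF f that] by simp
    have "emeasure ?\<mu> ((\<lambda>u. x + u) -` A) = emeasure lborel ((+) z -` (f -` A))"
      using 1 by (simp add: emeasure_distr z vimage_def add)
    also have "\<dots> = emeasure (distr lborel borel ((+) z)) (f -` A)"
      using 2 by (simp add: emeasure_distr m)
    finally show ?thesis by (simp add: lborel_distr_plus emeasure_distr that)
  qed
  \<comment> \<open>Exchanging the integrals requires the image measure to be sigma-finite; balls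
    about 0 are their own preimages, so it is finite on them.\<close>
  interpret \<mu>: sigma_finite_measure ?\<mu>
  proof
    have "emeasure ?\<mu> (ball 0 (real k)) \<noteq> \<infinity>" for k
    proof -
      have "f -` ball 0 (real k) = ball 0 (real k)" using isom by auto
      then show ?thesis
        using emeasure_lborel_ball_finite[of "0::'a" "real k"] by (simp add: emeasure_distr)
    qed
    moreover have "x \<in> (\<Union>k. ball (0::'a) (real k))" for x
      using reals_Archimedean2[of "norm x"] by auto
    ultimately show "\<exists>S. countable S \<and> S \<subseteq> sets ?\<mu> \<and> \<Union> S = space ?\<mu> \<and> (\<forall>a\<in>S. emeasure ?\<mu> a \<noteq> \<infinity>)"
      by (intro exI[of _ "range (\<lambda>k. ball (0::'a) (real k))"]) auto
  qed
  interpret P: pair_sigma_finite lborel ?\<mu> ..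
  fix A :: "'a set" assume "A \<in> sets ?\<mu>"
  then have A[measurable]: "A \<in> sets borel" by simp
  define IA IB :: "'a \<Rightarrow> ennreal" where "IA = indicator A" and "IB = indicator ?B"
  have [measurable]: "IA \<in> borel_measurable borel" "IB \<in> borel_measurable borel"
    unfolding IA_def IB_def by (auto intro!: borel_measurable_indicator)
  have IA: "(\<integral>\<^sup>+x. IA x \<partial>\<nu>) = emeasure \<nu> A" and IB: "(\<integral>\<^sup>+x. IB x \<partial>\<nu>) = emeasure \<nu> ?B"
    if "sets \<nu> = sets borel" for \<nu> :: "'a measure"
    using that by (simp_all add: IA_def IB_def)
  have "emeasure ?\<mu> A * emeasure lborel ?B = (\<integral>\<^sup>+y. IA y * emeasure lborel ?B \<partial>?\<mu>)"
    by (simp add: nn_integral_multc IA)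
  also have "\<dots> = (\<integral>\<^sup>+y. (\<integral>\<^sup>+x. IA y * IB (y - x) \<partial>lborel) \<partial>?\<mu>)"
  proof (rule nn_integral_cong)
    fix y :: 'a
    have "(\<integral>\<^sup>+x. IB (y - x) \<partial>lborel) = (\<integral>\<^sup>+x. indicator (ball y 1) x \<partial>lborel)"
      by (intro nn_integral_cong) (auto simp: IB_def indicator_def dist_norm norm_minus_commute)
    then show "IA y * emeasure lborel ?B = (\<integral>\<^sup>+x. IA y * IB (y - x) \<partial>lborel)"
      by (subst nn_integral_cmult) (auto simp: emeasure_ball)
  qed
  also have "\<dots> = (\<integral>\<^sup>+x. (\<integral>\<^sup>+y. IA y * IB (y - x) \<partial>?\<mu>) \<partial>lborel)"
    by (rule P.Fubini') measurable
  also have "\<dots> = (\<integral>\<^sup>+x. (\<integral>\<^sup>+y. IA (x + y) * IB y \<partial>?\<mu>) \<partial>lborel)"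
  proof (rule nn_integral_cong)
    fix x :: 'a
    have eq: "distr ?\<mu> borel ((+) x) = ?\<mu>"
      by (rule measure_eqI) (auto simp: emeasure_distr[of "(+) x"] \<mu>_translate[unfolded vimage_def] vimage_def)
    show "(\<integral>\<^sup>+y. IA y * IB (y - x) \<partial>?\<mu>) = (\<integral>\<^sup>+y. IA (x + y) * IB y \<partial>?\<mu>)"
      by (subst (1) eq[symmetric], subst nn_integral_distr) auto
  qed
  also have "\<dots> = (\<integral>\<^sup>+y. (\<integral>\<^sup>+x. IA (x + y) * IB y \<partial>lborel) \<partial>?\<mu>)"
    by (rule P.Fubini'[symmetric]) measurable
  also have "\<dots> = (\<integral>\<^sup>+y. emeasure lborel A * IB y \<partial>?\<mu>)"
  proof (rule nn_integral_cong)
    fix y :: 'a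
    have "(\<integral>\<^sup>+x. IA (x + y) \<partial>lborel) = (\<integral>\<^sup>+x. IA x \<partial>distr lborel borel ((+) y))"
      by (subst nn_integral_distr) (auto simp: add.commute)
    then show "(\<integral>\<^sup>+x. IA (x + y) * IB y \<partial>lborel) = emeasure lborel A * IB y"
      by (simp add: nn_integral_multc lborel_distr_plus IA)
  qed
  also have "\<dots> = emeasure lborel A * emeasure lborel ?B"
    by (simp add: nn_integral_cmult IB \<mu>_ball)
  finally have *: "emeasure ?\<mu> A * emeasure lborel ?B = emeasure lborel A * emeasure lborel ?B" .
  \<comment> \<open>The common factor may be cancelled because the unit ball has positive finite
    measure.\<close>
  have "emeasure lborel ?B \<noteq> 0" "emeasure lborel ?B \<noteq> \<infinity>"
    using emeasure_lborel_ball_finite[of "0::'a" 1] content_ball_pos[of 1 "0::'a"]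
    by (auto simp: measure_def)
  with * show "emeasure ?\<mu> A = emeasure lborel A"
    by (simp add: mult.commute[of _ "emeasure lborel ?B"] ennreal_mult_cancel_left)
qed simp

section \<open>Rotations of the kernel\<close>

lemma linear_herm: "linear (\<lambda>\<zeta>. herm \<zeta> (\<eta> :: complex ^ 'n))"
  by (intro linearI) (simp_all add: herm_def sum.distrib scaleR_sum_right algebra_simps)

lemma norm_herm_le: "norm (herm \<zeta> \<eta>) \<le> norm \<zeta> * norm (\<eta> :: complex ^ 'n)"
proof -
  have "norm (herm \<zeta> \<eta>) \<le> (\<Sum>j\<in>UNIV. \<bar>norm (\<zeta> $ j)\<bar> * \<bar>norm (\<eta> $ j)\<bar>)"
    unfolding herm_def by (rule sum_norm_le) (simp add: norm_mult)
  also have "\<dots> \<le> norm \<zeta> * norm \<eta>"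
    unfolding norm_vec_def by (rule L2_set_mult_ineq)
  finally show ?thesis .
qed

lemma herm_smult_left: "herm (c *s \<zeta>) \<eta> = c * herm \<zeta> (\<eta> :: complex ^ 'n)"
  by (simp add: herm_def sum_distrib_left mult.assoc)

lemma herm_smult_right: "herm \<zeta> (c *s \<eta>) = cnj c * herm \<zeta> (\<eta> :: complex ^ 'n)"
  by (simp add: herm_def sum_distrib_left ac_simps)

lemma norm_cis_smult [simp]: "norm (cis \<theta> *s \<zeta>) = norm (\<zeta> :: complex ^ 'n)"
  by (simp add: norm_vec_def norm_mult)

definition rot :: "real \<Rightarrow> 'n::finite heis \<Rightarrow> 'n heis" where
  "rot \<theta> \<alpha> = (cis \<theta> *s fst \<alpha>, snd \<alpha>)"

lemma linear_rot: "linear (rot \<theta>)"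
  by (intro linearI) (auto simp: rot_def vec_eq_iff algebra_simps)

lemma norm_rot: "norm (rot \<theta> \<alpha>) = norm \<alpha>"
  by (cases \<alpha>) (simp add: rot_def norm_Pair)

lemma continuous_on_rot: "continuous_on S (\<lambda>p. rot (fst p) (snd p :: 'n::finite heis))"
proof -
  have "continuous_on S (\<lambda>p. (\<chi> j. cis (fst p) * fst (snd p :: 'n heis) $ j, snd (snd p)))"
    by (intro continuous_intros)
  then show ?thesis
    by (simp add: rot_def vector_scalar_mult_def)
qed

lemma rot_measurable [measurable]:
  "(\<lambda>p. rot (fst p) (snd p :: 'n::finite heis)) \<in> borel_measurable (borel \<Otimes>\<^sub>M borel)"
  using borel_measurable_continuous_onI[OF continuous_on_rot[of UNIV]] by (simp add: borel_prod)

text \<open>The Hermitian product lets a phase pass from one argument to the other as its conjugate,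
  and \<open>kernel_C\<close> sees only norms and heights. Averaging in the variable thus becomes
  averaging over poles.\<close>

lemma g_kernel_rot: "g_kernel a \<beta> (rot \<theta> \<alpha>) = g_kernel a (rot (- \<theta>) \<beta>) \<alpha>"
  by (simp add: g_kernel_def kernel_C_def kernel_Q_def rot_def herm_smult_left herm_smult_right cis_cnj)

lemma circ_average_rot:
  "circ_average f \<alpha> = (1 / (2 * pi)) *\<^sub>R (LINT \<theta>:{0..2 * pi}|lborel. f (rot \<theta> \<alpha>))"
  by (simp add: circ_average_def rot_def)

lemma g_kernel_measurable [measurable]:
  "g_kernel a (\<beta> :: 'n::finite heis) \<in> borel_measurable borel"
proof -
  have [measurable]: "(\<lambda>\<alpha>. kernel_C \<beta> \<alpha> - kernel_Q \<beta> \<alpha>) \<in> borel_measurable borel"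
    unfolding kernel_C_def kernel_Q_def herm_def
    by (intro borel_measurable_continuous_onI continuous_intros)
  show ?thesis unfolding g_kernel_def by measurable
qed

section \<open>Smooth functions and the sub-Laplacian\<close>

lemma smooth_fun_dir_deriv: "smooth_fun (dir_deriv v f)" if "smooth_fun f" "v \<in> Basis"
  unfolding smooth_fun_def
proof (intro allI impI)
  fix vs p assume "set vs \<subseteq> (Basis :: 'a set)"
  \<comment> \<open>\<open>foldr\<close> applies the last entry of its list first, so appending
    \<open>v\<close> puts that derivative innermost.\<close>
  then show "foldr dir_deriv vs (dir_deriv v f) differentiable at p"
    using that unfolding smooth_fun_def by (auto dest!: spec[of _ "vs @ [v]"])
qed

lemma smooth_fun_differentiable: "f differentiable at p" if "smooth_fun f"
  using that unfolding smooth_fun_def by (auto dest!: spec[of _ "[]"])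

lemma smooth_fun_continuous_on: "continuous_on S f" if "smooth_fun f"
  by (intro continuous_at_imp_continuous_on ballI differentiable_imp_continuous_within
      smooth_fun_differentiable that)

lemma dir_deriv_eq:
  assumes "(f has_derivative f') (at p)"
  shows "dir_deriv v f p = f' v"
proof -
  interpret f': bounded_linear f' by (rule has_derivative_bounded_linear[OF assms])
  have "((\<lambda>s::real. f (p + s *\<^sub>R v)) has_derivative (\<lambda>s. f' (s *\<^sub>R v))) (at 0)"
    by (rule has_derivative_compose[where g = f and f = "\<lambda>s. p + s *\<^sub>R v"])
       (auto intro!: derivative_eq_intros simp: assms)
  then show ?thesis
    unfolding dir_deriv_def
    by (intro vector_derivative_at) (simp add: has_vector_derivative_def f'.scaleR)
qed

lemma dir_deriv_add_scaleR:
  assumes "h differentiable at p" "k differentiable at p" "bounded_linear l"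
  shows "dir_deriv v (\<lambda>x. h x + l x *\<^sub>R k x) p
    = dir_deriv v h p + (l p *\<^sub>R dir_deriv v k p + l v *\<^sub>R k p)"
proof -
  obtain h' k' where h: "(h has_derivative h') (at p)" and k: "(k has_derivative k') (at p)"
    using assms by (auto simp: differentiable_def)
  have "((\<lambda>x. h x + l x *\<^sub>R k x) has_derivative (\<lambda>v. h' v + (l p *\<^sub>R k' v + l v *\<^sub>R k p))) (at p)"
    by (intro has_derivative_add has_derivative_scaleR h k bounded_linear_imp_has_derivative assms)
  from dir_deriv_eq[OF this] show ?thesis by (simp add: dir_deriv_eq[OF h] dir_deriv_eq[OF k])
qed

text \<open>The product rule expands \<open>V (V \<phi>)\<close> into iterated coordinate
  derivatives of \<open>\<phi>\<close> with coefficients polynomial in \<open>l\<close>. Both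
  \<open>vf_X j\<close> and \<open>vf_Y j\<close> have this shape, with \<open>w\<close> the
  vertical direction; the minus sign of \<open>vf_Y j\<close> goes into \<open>l\<close>.\<close>

lemma smooth_fun_continuous_iterated_field:
  fixes l :: "'a::euclidean_space \<Rightarrow> real"
  assumes \<phi>: "smooth_fun \<phi>" and "v \<in> Basis" "w \<in> Basis" and l: "bounded_linear l"
  defines "V \<equiv> \<lambda>f p. dir_deriv v f p + l p *\<^sub>R dir_deriv w f p"
  shows "continuous_on S (V (V \<phi>))"
proof -
  note sm = smooth_fun_dir_deriv[OF _ \<open>v \<in> Basis\<close>] smooth_fun_dir_deriv[OF _ \<open>w \<in> Basis\<close>]
  have cl: "continuous_on S l" using l by (rule linear_continuous_on)
  show ?thesis
    unfolding V_def
    by (simp add: dir_deriv_add_scaleR smooth_fun_differentiable sm \<phi> l)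
       (intro continuous_intros cl smooth_fun_continuous_on sm \<phi>)
qed

lemma continuous_on_Delta0:
  assumes "smooth_fun (\<phi> :: 'n::finite heis \<Rightarrow> 'b::real_normed_vector)"
  shows "continuous_on S (Delta0 \<phi>)"
proof -
  have X: "continuous_on S (vf_X j (vf_X j \<phi>))" for j
  proof -
    have "bounded_linear (\<lambda>\<alpha>::'n heis. 2 * Im (fst \<alpha> $ j))"
      by (simp add: linear_conv_bounded_linear[symmetric] linear_iff algebra_simps)
    from smooth_fun_continuous_iterated_field[OF assms _ _ this, of "(axis j 1, 0)" "(0, 1)"]
    show ?thesis by (simp add: vf_X_def[abs_def] Basis_prod_def Basis_complex_def image_iff axis_in_Basis_iff)
  qed
  have Y: "continuous_on S (vf_Y j (vf_Y j \<phi>))" for j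
  proof -
    have "bounded_linear (\<lambda>\<alpha>::'n heis. - (2 * Re (fst \<alpha> $ j)))"
      by (simp add: linear_conv_bounded_linear[symmetric] linear_iff algebra_simps)
    from smooth_fun_continuous_iterated_field[OF assms _ _ this, of "(axis j \<i>, 0)" "(0, 1)"]
    show ?thesis by (simp add: vf_Y_def[abs_def] Basis_prod_def Basis_complex_def image_iff axis_in_Basis_iff)
  qed
  show ?thesis
    unfolding Delta0_def[abs_def] by (intro continuous_intros X Y)
qed

lemma dir_deriv_eq_0:
  assumes "open U" "p \<in> U" "\<And>x. x \<in> U \<Longrightarrow> f x = 0"
  shows "dir_deriv v f p = 0"
proof -
  have "(f has_derivative (\<lambda>_. 0)) (at p)"
    by (rule has_derivative_transform_within_open[OF has_derivative_const[of 0] assms(1,2)])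
       (simp add: assms)
  from dir_deriv_eq[OF this] show ?thesis .
qed

text \<open>Locality of the operator: it is used on the complement of the support of a test
  function, to confine \<open>Delta0 \<phi>\<close> to that support.\<close>

lemma Delta0_eq_0:
  assumes "open U" "p \<in> U" "\<And>x. x \<in> U \<Longrightarrow> f x = 0"
  shows "Delta0 f p = 0"
proof -
  have "vf_X j f x = 0" "vf_Y j f x = 0" if "x \<in> U" for x j
    using that assms by (simp_all add: vf_X_def vf_Y_def dir_deriv_eq_0[OF assms(1)])
  then have "vf_X j (vf_X j f) p = 0" "vf_Y j (vf_Y j f) p = 0" for j
    using assms(2) by (simp_all add: vf_X_def[of j "vf_X j f"] vf_Y_def[of j "vf_Y j f"] dir_deriv_eq_0[OF assms(1)])
  then show ?thesis by (simp add: Delta0_def)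
qed

section \<open>Circular averages as distributions\<close>

lemma nn_integral_rot:
  fixes f :: "'n::finite heis \<Rightarrow> ennreal"
  assumes [measurable]: "f \<in> borel_measurable borel"
  shows "(\<integral>\<^sup>+\<alpha>. f (rot \<theta> \<alpha>) \<partial>lborel) = (\<integral>\<^sup>+\<alpha>. f \<alpha> \<partial>lborel)"
proof -
  have [measurable]: "rot \<theta> \<in> borel_measurable (borel :: 'n heis measure)"
    by (intro borel_measurable_continuous_onI linear_continuous_on)
       (simp add: linear_rot linear_conv_bounded_linear[symmetric])
  have "(\<integral>\<^sup>+\<alpha>. f (rot \<theta> \<alpha>) \<partial>lborel) = (\<integral>\<^sup>+\<alpha>. f \<alpha> \<partial>distr lborel borel (rot \<theta>))"
    by (simp add: nn_integral_distr)
  then show ?thesis by (simp add: lborel_distr_isometry linear_rot norm_rot)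
qed

text \<open>The hypothesis of Fubini's theorem, checked with Tonelli. For fixed angle the inner
  integral is at most \<open>M\<close> times the integral of |u| over the ball, because rotations
  preserve both the ball and the measure. This bound does not depend on the angle, and the angles
  fill a bounded interval.\<close>

lemma integrable_rotated:
  fixes u :: "'n::finite heis \<Rightarrow> real" and \<psi> :: "'n heis \<Rightarrow> 'b::{banach, second_countable_topology}"
  assumes [measurable]: "u \<in> borel_measurable borel" "\<psi> \<in> borel_measurable borel"
    and u: "set_integrable lborel (cball 0 r) u"
    and bound: "\<And>\<alpha>. norm (\<psi> \<alpha>) \<le> M" and supp: "\<And>\<alpha>. \<alpha> \<notin> cball 0 r \<Longrightarrow> \<psi> \<alpha> = 0"
  shows "integrable (lborel \<Otimes>\<^sub>M lborel)
    (\<lambda>(\<theta>, \<alpha>). indicat_real {0..2 * pi} \<theta> *\<^sub>R (u (rot \<theta> \<alpha>) *\<^sub>R \<psi> \<alpha>))"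
proof (rule integrableI_bounded)
  let ?f = "\<lambda>(\<theta>, \<alpha>). indicat_real {0..2 * pi} \<theta> *\<^sub>R (u (rot \<theta> \<alpha>) *\<^sub>R \<psi> \<alpha>)"
  have [measurable]: "(\<lambda>p. rot (fst p) (snd p :: 'n heis)) \<in> borel_measurable (lborel \<Otimes>\<^sub>M lborel)"
    using rot_measurable by (simp cong: measurable_cong_sets add: borel_prod lborel_prod)
  have [measurable]: "cball (0 :: 'n heis) r \<in> sets borel" by simp
  have split: "?f = (\<lambda>p. indicator {0..2 * pi} (fst p) *\<^sub>R (u (rot (fst p) (snd p)) *\<^sub>R \<psi> (snd p)))"
    by (simp add: split_beta')
  show f[measurable]: "?f \<in> borel_measurable (lborel \<Otimes>\<^sub>M lborel)"
    unfolding split by measurable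
  define I where "I = (\<integral>\<^sup>+\<alpha>. ennreal (norm (indicat_real (cball 0 r) \<alpha> *\<^sub>R u \<alpha>)) \<partial>lborel)"
  have I: "I < \<infinity>"
    using u unfolding I_def set_integrable_def integrable_iff_bounded by simp
  have "(\<integral>\<^sup>+p. ennreal (norm (?f p)) \<partial>(lborel \<Otimes>\<^sub>M lborel))
      = (\<integral>\<^sup>+\<theta>. (\<integral>\<^sup>+\<alpha>. ennreal (norm (?f (\<theta>, \<alpha>))) \<partial>lborel) \<partial>lborel)"
    by (rule lborel.nn_integral_fst[symmetric]) measurable
  also have "\<dots> \<le> (\<integral>\<^sup>+\<theta>. ennreal M * I * indicator {0..2 * pi} \<theta> \<partial>lborel)"
  proof (rule nn_integral_mono)
    fix \<theta> :: real
    have "(\<integral>\<^sup>+\<alpha>. ennreal (norm (?f (\<theta>, \<alpha>))) \<partial>lborel)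
      \<le> (\<integral>\<^sup>+\<alpha>. (ennreal M * indicator {0..2 * pi} \<theta>) *
            ennreal (norm (indicat_real (cball 0 r) (rot \<theta> \<alpha>) *\<^sub>R u (rot \<theta> \<alpha>))) \<partial>(lborel :: 'n heis measure))"
    proof (rule nn_integral_mono)
      fix \<alpha> :: "'n heis"
      have "M \<ge> 0" using norm_ge_zero[of "\<psi> \<alpha>"] bound[of \<alpha>] by linarith
      moreover have "norm (?f (\<theta>, \<alpha>)) \<le> (M * indicator {0..2 * pi} \<theta>) *
          norm (indicat_real (cball 0 r) (rot \<theta> \<alpha>) *\<^sub>R u (rot \<theta> \<alpha>))"
        using supp[of \<alpha>] mult_right_mono[OF bound[of \<alpha>], of "\<bar>u (rot \<theta> \<alpha>)\<bar>"]
        by (cases "\<alpha> \<in> cball 0 r") (auto simp: norm_rot indicator_def mult.commute)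
      ultimately show "ennreal (norm (?f (\<theta>, \<alpha>))) \<le> (ennreal M * indicator {0..2 * pi} \<theta>) *
          ennreal (norm (indicat_real (cball 0 r) (rot \<theta> \<alpha>) *\<^sub>R u (rot \<theta> \<alpha>)))"
        by (auto simp: indicator_def ennreal_mult[symmetric] intro!: ennreal_leI)
    qed
    also have "\<dots> = (\<integral>\<^sup>+\<alpha>. (ennreal M * indicator {0..2 * pi} \<theta>) *
            ennreal (norm (indicat_real (cball 0 r) \<alpha> *\<^sub>R u \<alpha>)) \<partial>(lborel :: 'n heis measure))"
      by (rule nn_integral_rot[where f = "\<lambda>\<alpha>. (ennreal M * indicator {0..2 * pi} \<theta>) *
            ennreal (norm (indicat_real (cball 0 r) \<alpha> *\<^sub>R u \<alpha>))"]) measurable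
    also have "\<dots> = ennreal M * I * indicator {0..2 * pi} \<theta>"
      by (simp add: nn_integral_cmult I_def ac_simps)
    finally show "(\<integral>\<^sup>+\<alpha>. ennreal (norm (?f (\<theta>, \<alpha>))) \<partial>lborel) \<le> ennreal M * I * indicator {0..2 * pi} \<theta>" .
  qed
  also have "\<dots> < \<infinity>"
    using I by (simp add: nn_integral_cmult ennreal_mult_less_top)
  finally show "(\<integral>\<^sup>+p. ennreal (norm (?f p)) \<partial>(lborel \<Otimes>\<^sub>M lborel)) < \<infinity>" .
qed

lemma circ_average_pairing:
  fixes u :: "'n::finite heis \<Rightarrow> real" and \<psi> :: "'n heis \<Rightarrow> complex"
  assumes [measurable]: "u \<in> borel_measurable borel" "\<psi> \<in> borel_measurable borel"
    and "set_integrable lborel (cball 0 r) u"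
    and "\<And>\<alpha>. norm (\<psi> \<alpha>) \<le> M" and "\<And>\<alpha>. \<alpha> \<notin> cball 0 r \<Longrightarrow> \<psi> \<alpha> = 0"
  shows "integrable lborel (\<lambda>\<alpha>. circ_average u \<alpha> *\<^sub>R \<psi> \<alpha>)"
    and "(LINT \<alpha>|lborel. circ_average u \<alpha> *\<^sub>R \<psi> \<alpha>) =
      (1 / (2 * pi)) *\<^sub>R (LINT \<theta>:{0..2 * pi}|lborel. LINT \<alpha>|lborel. u (rot \<theta> \<alpha>) *\<^sub>R \<psi> \<alpha>)"
proof -
  let ?f = "\<lambda>\<theta> \<alpha>. indicat_real {0..2 * pi} \<theta> *\<^sub>R (u (rot \<theta> \<alpha>) *\<^sub>R \<psi> \<alpha>)"
  have f: "integrable (lborel \<Otimes>\<^sub>M lborel) (\<lambda>(\<theta>, \<alpha>). ?f \<theta> \<alpha>)"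
    using assms by (rule integrable_rotated)
  \<comment> \<open>Valid at every point, even where the circle integral diverges: the Bochner
    integral then takes the default value 0 on both sides. The factor \<open>\<psi> \<alpha>\<close>
    is written as a complex multiplier so that it can be pulled out without an integrability
    condition.\<close>
  have avg: "circ_average u \<alpha> *\<^sub>R \<psi> \<alpha> = (1 / (2 * pi)) *\<^sub>R (LINT \<theta>|lborel. ?f \<theta> \<alpha>)" for \<alpha>
  proof -
    have "(LINT \<theta>|lborel. ?f \<theta> \<alpha>) =
        (LINT \<theta>|lborel. complex_of_real (indicat_real {0..2 * pi} \<theta> *\<^sub>R u (rot \<theta> \<alpha>)) * \<psi> \<alpha>)"
      by (simp add: scaleR_conv_of_real mult.assoc)
    then show ?thesis
      by (simp only: integral_mult_left_zero integral_complex_of_real circ_average_rot set_lebesgue_integral_def)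
         (simp add: scaleR_conv_of_real)
  qed
  show "integrable lborel (\<lambda>\<alpha>. circ_average u \<alpha> *\<^sub>R \<psi> \<alpha>)"
    unfolding avg using lborel_pair.integrable_snd[OF f] by simp
  show "(LINT \<alpha>|lborel. circ_average u \<alpha> *\<^sub>R \<psi> \<alpha>) =
      (1 / (2 * pi)) *\<^sub>R (LINT \<theta>:{0..2 * pi}|lborel. LINT \<alpha>|lborel. u (rot \<theta> \<alpha>) *\<^sub>R \<psi> \<alpha>)"
    unfolding avg using lborel_pair.Fubini_integral[OF f]
    by (simp add: set_lebesgue_integral_def del: scaleR_scaleR)
qed

lemma set_integrable_circ_average:
  fixes u :: "'n::finite heis \<Rightarrow> real"
  assumes "u \<in> borel_measurable borel" "\<And>r. set_integrable lborel (cball 0 r) u" "compact K"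
  shows "set_integrable lborel K (circ_average u)"
proof -
  obtain r where r: "K \<subseteq> cball 0 r"
    using compact_imp_bounded[OF \<open>compact K\<close>] by (force simp: bounded_iff subset_eq)
  have K: "K \<in> sets borel" using \<open>compact K\<close> by (rule borel_compact)
  \<comment> \<open>Local integrability is the pairing with the indicator of \<open>K\<close>, made
    complex-valued to fit the pairing lemma and then brought back by taking real parts.\<close>
  have "integrable lborel (\<lambda>\<alpha>. circ_average u \<alpha> *\<^sub>R (indicator K \<alpha> :: complex))"
    by (rule circ_average_pairing(1)[OF assms(1) _ assms(2), where M = 1 and r = r])
       (use K r in \<open>auto simp: indicator_def\<close>)
  from integrable_Re[OF this] have "integrable lborel (\<lambda>\<alpha>. circ_average u \<alpha> * Re (indicator K \<alpha>))"
    by simp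
  moreover have "Re (indicator K \<alpha>) = indicat_real K \<alpha>" for \<alpha>
    by (simp add: indicator_def)
  ultimately show ?thesis
    by (simp add: set_integrable_def mult.commute)
qed

text \<open>The substitution \<theta> -> 2 pi - \<theta> preserves the interval, and periodicity
  drops the 2 pi. It is needed because rotating the variable rotates the pole backwards.\<close>

lemma integral_circle_flip:
  fixes f :: "real \<Rightarrow> complex"
  assumes "\<And>\<theta>. f (\<theta> + 2 * pi) = f \<theta>"
  shows "(LINT \<theta>:{0..2 * pi}|lborel. f (- \<theta>)) = (LINT \<theta>:{0..2 * pi}|lborel. f \<theta>)"
proof -
  have "(LINT \<theta>:{0..2 * pi}|lborel. f \<theta>) =
      (LINT \<theta>|lborel. indicat_real {0..2 * pi} (2 * pi + - 1 * \<theta>) *\<^sub>R f (2 * pi + - 1 * \<theta>))"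
    unfolding set_lebesgue_integral_def by (subst lborel_integral_real_affine[of "- 1" _ "2 * pi"]) simp_all
  also have "\<dots> = (LINT \<theta>:{0..2 * pi}|lborel. f (- \<theta>))"
    unfolding set_lebesgue_integral_def
    using assms[of "- x" for x]
    by (intro Bochner_Integration.integral_cong) (auto simp: indicator_def)
  finally show ?thesis by simp
qed

section \<open>Pairing averaged fundamental solutions with test functions\<close>

lemma normalizing_constantD:
  fixes \<beta> :: "'n::finite heis"
  assumes "normalizing_constant TYPE('n) a"
  shows "compact K \<Longrightarrow> set_integrable lborel K (g_kernel a \<beta>)"
    and "test_function UNIV \<phi> \<Longrightarrow> (LINT \<alpha>|lborel. g_kernel a \<beta> \<alpha> *\<^sub>R Delta0 \<phi> \<alpha>) = \<phi> \<beta>"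
  using assms unfolding normalizing_constant_def Delta0_eq_delta_def by blast+

lemma circ_average_g_kernel_pairing:
  fixes \<beta> :: "'n::finite heis"
  assumes nc: "normalizing_constant TYPE('n) a" and \<phi>: "test_function UNIV \<phi>"
  shows "integrable lborel (\<lambda>\<alpha>. circ_average (g_kernel a \<beta>) \<alpha> *\<^sub>R Delta0 \<phi> \<alpha>)"
    and "(LINT \<alpha>|lborel. circ_average (g_kernel a \<beta>) \<alpha> *\<^sub>R Delta0 \<phi> \<alpha>) = circ_average \<phi> \<beta>"
proof -
  have smooth: "smooth_fun \<phi>" and comp: "compact (closure {p. \<phi> p \<noteq> 0})"
    using \<phi> by (auto simp: test_function_def)
  let ?K = "closure {p. \<phi> p \<noteq> 0}"
  have cont: "continuous_on S (Delta0 \<phi>)" for S using smooth by (rule continuous_on_Delta0)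
  have outside: "Delta0 \<phi> \<alpha> = 0" if "\<alpha> \<notin> ?K" for \<alpha>
    by (rule Delta0_eq_0[of "- ?K"]) (use that closure_subset[of "{p. \<phi> p \<noteq> 0}"] in auto)
  obtain r where r: "?K \<subseteq> cball 0 r"
    using compact_imp_bounded[OF comp] by (force simp: bounded_iff subset_eq)
  have "bounded (Delta0 \<phi> ` ?K)"
    using cont comp by (intro compact_imp_bounded compact_continuous_image)
  then obtain M where M: "\<And>\<alpha>. \<alpha> \<in> ?K \<Longrightarrow> norm (Delta0 \<phi> \<alpha>) \<le> M"
    unfolding bounded_iff by blast
  \<comment> \<open>The maximum with 0 covers the points outside the support, where \<open>M\<close>
    gives no information and could even be negative if the support is empty.\<close>
  have bound: "norm (Delta0 \<phi> \<alpha>) \<le> max M 0" for \<alpha>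
    using M[of \<alpha>] outside[of \<alpha>] by (cases "\<alpha> \<in> ?K") auto
  have int: "set_integrable lborel (cball 0 r) (g_kernel a \<beta>)"
    by (rule normalizing_constantD(1)[OF nc compact_cball])
  have outside_ball: "Delta0 \<phi> \<alpha> = 0" if "\<alpha> \<notin> cball 0 r" for \<alpha>
    using r that by (blast intro: outside)
  note * = circ_average_pairing[OF g_kernel_measurable borel_measurable_continuous_onI[OF cont]
      int bound outside_ball]
  show "integrable lborel (\<lambda>\<alpha>. circ_average (g_kernel a \<beta>) \<alpha> *\<^sub>R Delta0 \<phi> \<alpha>)"
    by (rule *(1))
  have delta: "(LINT \<alpha>|lborel. g_kernel a \<beta> (rot \<theta> \<alpha>) *\<^sub>R Delta0 \<phi> \<alpha>) = \<phi> (rot (- \<theta>) \<beta>)" for \<theta>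
    unfolding g_kernel_rot by (rule normalizing_constantD(2)[OF nc \<phi>])
  have "(LINT \<alpha>|lborel. circ_average (g_kernel a \<beta>) \<alpha> *\<^sub>R Delta0 \<phi> \<alpha>) =
      (1 / (2 * pi)) *\<^sub>R (LINT \<theta>:{0..2 * pi}|lborel. \<phi> (rot (- \<theta>) \<beta>))"
    by (rule trans[OF *(2)], assumption, simp only: delta)
  also have "(LINT \<theta>:{0..2 * pi}|lborel. \<phi> (rot (- \<theta>) \<beta>)) = (LINT \<theta>:{0..2 * pi}|lborel. \<phi> (rot \<theta> \<beta>))"
    by (rule integral_circle_flip) (simp add: rot_def flip: cis_mult)
  finally show "(LINT \<alpha>|lborel. circ_average (g_kernel a \<beta>) \<alpha> *\<^sub>R Delta0 \<phi> \<alpha>) = circ_average \<phi> \<beta>"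
    by (simp add: circ_average_rot)
qed

lemma neumann_G_Delta0:
  fixes \<beta> :: "'n::finite heis"
  assumes nc: "normalizing_constant TYPE('n) a" and \<beta>: "\<beta> \<in> half_space"
  shows "Delta0_eq_delta half_space circular (neumann_G a \<beta>) \<beta>"
  unfolding Delta0_eq_delta_def
proof (intro conjI allI impI)
  fix K :: "'n heis set" assume K: "compact K \<and> K \<subseteq> half_space"
  have "set_integrable lborel (cball 0 r) (g_kernel a \<gamma>)" for r and \<gamma> :: "'n heis"
    by (rule normalizing_constantD(1)[OF nc compact_cball])
  then show "set_integrable lborel K (neumann_G a \<beta>)"
    unfolding neumann_G_def[abs_def]
    using K by (intro set_integral_add(1) set_integrable_circ_average g_kernel_measurable) auto
next
  fix \<phi> :: "'n heis \<Rightarrow> complex"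
  assume \<phi>: "test_function half_space \<phi> \<and> circular \<phi>"
  \<comment> \<open>The fundamental solution property is available on the whole group, so
    \<open>\<phi>\<close> is regarded as a test function there.\<close>
  then have test: "test_function UNIV \<phi>" by (simp add: test_function_def)
  have "\<phi> \<alpha> = 0" if "\<alpha> \<notin> half_space" for \<alpha>
    using \<phi> that closure_subset[of "{p. \<phi> p \<noteq> 0}"] by (auto simp: test_function_def)
  \<comment> \<open>The whole circle through the reflected pole lies at height -t' < 0, outside the
    half-space.\<close>
  then have "circ_average \<phi> (reflect \<beta>) = 0"
    using \<beta> by (simp add: circ_average_def half_space_def reflect_def)
  moreover have "circ_average \<phi> \<beta> = \<phi> \<beta>" using \<phi> by (simp add: circular_def)
  ultimately show "(LINT \<alpha>|lborel. neumann_G a \<beta> \<alpha> *\<^sub>R Delta0 \<phi> \<alpha>) = \<phi> \<beta>"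
    by (simp add: neumann_G_def scaleR_add_left circ_average_g_kernel_pairing[OF nc test])
qed

section \<open>The circle integral\<close>

lemma integral_flip_interval: "integral {a..b} (\<lambda>x. f (a + b - x)) = integral {a..b} (f :: real \<Rightarrow> real)"
proof -
  have "integral {a..b} (\<lambda>x. f (a + b - x)) = integral {- b..- a} (\<lambda>x. f (a + b + x))"
    using Henstock_Kurzweil_Integration.integral_reflect_real[of "- a" "- b" "\<lambda>x. f (a + b + x)"] by simp
  also have "\<dots> = integral {a..b} f"
    using integral_shift_Icc_real[of "- b" "- a" f "a + b"] by (simp add: o_def)
  finally show ?thesis .
qed

lemma integral_periodic_shift:
  fixes f :: "real \<Rightarrow> real"
  assumes cont: "continuous_on UNIV f" and per: "\<And>x. f (x + p) = f x" and c: "0 \<le> c" "c \<le> p"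
  shows "integral {0..p} (\<lambda>x. f (x + c)) = integral {0..p} f"
proof -
  have int: "f integrable_on {a..b}" for a b
    by (intro integrable_continuous_interval continuous_on_subset[OF cont]) auto
  have "integral {0..p} (\<lambda>x. f (x + c)) = integral {c..p + c} f"
    using integral_shift_Icc_real[of 0 p f c] by (simp add: add.commute o_def)
  also have "\<dots> = integral {c..p} f + integral {p..p + c} f"
    using c by (intro Henstock_Kurzweil_Integration.integral_combine[symmetric] int) auto
  also have "integral {p..p + c} f = integral {0..c} f"
    using integral_shift_Icc_real[of 0 c f p] by (simp add: o_def per add.commute[of p])
  also have "integral {c..p} f + integral {0..c} f = integral {0..p} f"
    using c Henstock_Kurzweil_Integration.integral_combine[OF c int] by simp
  finally show ?thesis .
qed

text \<open>With \<open>A\<close> the value of \<open>kernel_C\<close> and \<open>w\<close> the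
  Hermitian product, this is the averaged kernel up to a constant factor. The relevant region is
  2|w| < |A|, where the denominator does not vanish for any angle.\<close>

definition circle_integral :: "nat \<Rightarrow> complex \<Rightarrow> complex \<Rightarrow> real" where
  "circle_integral n A w = integral {0..2 * pi} (\<lambda>\<theta>. inverse (norm (A - 2 * cis \<theta> * w) ^ n))"

lemma circle_denom_nonzero:
  assumes "2 * norm w < norm A"
  shows "A - 2 * cis \<theta> * w \<noteq> 0"
proof
  assume "A - 2 * cis \<theta> * w = 0"
  then have "norm A = norm (2 * cis \<theta> * w)" by simp
  then show False using assms by (simp add: norm_mult)
qed

lemma continuous_on_circle_integrand:
  assumes "2 * norm w < norm A"
  shows "continuous_on S (\<lambda>\<theta>. inverse (norm (A - 2 * cis \<theta> * w) ^ n))"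
  using circle_denom_nonzero[OF assms] by (intro continuous_intros) auto

text \<open>The argument of \<open>w\<close> is absorbed into a shift of the angle, which an
  integral over a full period does not see.\<close>

lemma circle_integral_phase:
  assumes "2 * norm w < norm A"
  shows "circle_integral n A w = circle_integral n A (of_real (norm w))"
proof -
  have w: "w = cis (Arg2pi w) * of_real (norm w)"
    using Arg2pi_eq[of w] by (simp add: cis_conv_exp mult.commute)
  let ?f = "\<lambda>\<theta>. inverse (norm (A - 2 * cis \<theta> * of_real (norm w)) ^ n)"
  have rotated: "A - 2 * cis \<theta> * w = A - 2 * cis (\<theta> + Arg2pi w) * of_real (norm w)" for \<theta>
    by (subst (1) w) (simp only: cis_mult[symmetric] mult.assoc)
  have "circle_integral n A w = integral {0..2 * pi} (\<lambda>\<theta>. ?f (\<theta> + Arg2pi w))"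
    unfolding circle_integral_def
    by (simp only: rotated)
  also have "\<dots> = integral {0..2 * pi} ?f"
    using assms Arg2pi_lt_2pi[of w] Arg2pi_ge_0[of w]
    by (intro integral_periodic_shift continuous_on_circle_integrand) (auto simp flip: cis_mult)
  finally show ?thesis by (simp add: circle_integral_def)
qed

text \<open>Once \<open>w\<close> is replaced by the real number |w|, conjugating the denominator
  trades the conjugation of \<open>A\<close> for a change of sign of the angle, which reflecting the
  interval undoes.\<close>

lemma circle_integral_cnj:
  assumes "2 * norm w < norm A"
  shows "circle_integral n (cnj A) w = circle_integral n A w"
proof -
  have "circle_integral n (cnj A) w = circle_integral n (cnj A) (of_real (norm w))"
    using assms by (intro circle_integral_phase) simp
  also have "\<dots> = circle_integral n A (of_real (norm w))"
  proof -
    have "norm (cnj A - 2 * cis \<theta> * of_real (norm w)) = norm (A - 2 * cis (0 + 2 * pi - \<theta>) * of_real (norm w))" for \<theta>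
    proof -
      have "cis (0 + 2 * pi - \<theta>) = cis (- \<theta>)"
        by (simp add: complex_eq_iff cos_diff sin_diff)
      then show ?thesis
        by (subst complex_mod_cnj[symmetric]) (simp only: complex_cnj_diff complex_cnj_mult cis_cnj
            complex_cnj_cnj complex_cnj_numeral complex_cnj_complex_of_real)
    qed
    then show ?thesis
      unfolding circle_integral_def
      using integral_flip_interval[of 0 "2 * pi" "\<lambda>\<theta>. inverse (norm (A - 2 * cis \<theta> * of_real (norm w)) ^ n)"]
      by simp
  qed
  also have "\<dots> = circle_integral n A w"
    using assms by (rule circle_integral_phase[symmetric])
  finally show ?thesis .
qed

text \<open>The chain rule in the variables (A, w): derivative of the inverse power, then the
  gradient \<open>sgn\<close> of the norm, then the linear map sending (A, w) to the denominator's
  argument. It takes values in bounded linear maps so that differentiation under the integral and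
  continuity in operator norm apply.\<close>

definition circle_integrand_deriv :: "nat \<Rightarrow> complex \<times> complex \<Rightarrow> real \<Rightarrow> (complex \<times> complex) \<Rightarrow>\<^sub>L real" where
  "circle_integrand_deriv n p \<theta> =
     (- (inverse (norm (fst p - 2 * cis \<theta> * snd p) ^ n))\<^sup>2 *
        (of_nat n * norm (fst p - 2 * cis \<theta> * snd p) ^ (n - 1))) *\<^sub>R
     (blinfun_inner_right (sgn (fst p - 2 * cis \<theta> * snd p)) o\<^sub>L
       (fst_blinfun - (blinfun_mult_right (2 * cis \<theta>) o\<^sub>L snd_blinfun)))"

lemma continuous_on_circle_integrand_deriv:
  assumes "\<And>p. p \<in> S \<Longrightarrow> 2 * norm (snd p) < norm (fst p)"
  shows "continuous_on (S \<times> T) (\<lambda>(p, \<theta>). circle_integrand_deriv n p \<theta>)"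
proof -
  have "fst (fst q) - 2 * cis (snd q) * snd (fst q) \<noteq> 0" if "q \<in> S \<times> T" for q
    using that by (intro circle_denom_nonzero assms) auto
  then show ?thesis
    unfolding circle_integrand_deriv_def split_beta
    by (intro continuous_intros bounded_linear.continuous_on[OF bounded_linear_blinfun_inner_right]
        bounded_linear.continuous_on[OF bounded_linear_blinfun_mult_right]) auto
qed

lemma circle_integrand_has_derivative:
  assumes "2 * norm (snd p) < norm (fst p)"
  shows "((\<lambda>p. inverse (norm (fst p - 2 * cis \<theta> * snd p) ^ n)) has_derivative
    blinfun_apply (circle_integrand_deriv n p \<theta>)) (at p within S)"
proof -
  let ?c = "\<lambda>p. fst p - 2 * cis \<theta> * snd p"
  have nz: "?c p \<noteq> 0" using circle_denom_nonzero[OF assms] .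
  have c: "(?c has_derivative (\<lambda>h. fst h - 2 * cis \<theta> * snd h)) (at p within S)"
    by (auto intro!: derivative_eq_intros)
  have N: "((\<lambda>p. norm (?c p)) has_derivative (\<lambda>h. inner (sgn (?c p)) (fst h - 2 * cis \<theta> * snd h))) (at p within S)"
    using has_derivative_compose[OF c has_derivative_norm[OF nz]]
    by (simp add: inner_commute)
  have "((\<lambda>p. inverse (norm (?c p) ^ n)) has_derivative
      (\<lambda>h. - (inverse (norm (?c p) ^ n) *
        (of_nat n * inner (sgn (?c p)) (fst h - 2 * cis \<theta> * snd h) * norm (?c p) ^ (n - 1)) *
        inverse (norm (?c p) ^ n)))) (at p within S)"
    by (intro Deriv.has_derivative_inverse has_derivative_power N) (use nz in simp)
  then show ?thesis
    unfolding circle_integrand_deriv_def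
    by (rule has_derivative_eq_rhs)
       (simp add: fun_eq_iff minus_blinfun.rep_eq uminus_blinfun.rep_eq scaleR_blinfun.rep_eq power2_eq_square ac_simps)
qed

definition circle_integral_deriv :: "nat \<Rightarrow> complex \<times> complex \<Rightarrow> (complex \<times> complex) \<Rightarrow>\<^sub>L real" where
  "circle_integral_deriv n p = integral {0..2 * pi} (circle_integrand_deriv n p)"

lemma circle_integral_has_derivative:
  assumes "2 * norm (snd p) < norm (fst p)"
  shows "((\<lambda>p. circle_integral n (fst p) (snd p)) has_derivative
    blinfun_apply (circle_integral_deriv n p)) (at p)"
proof -
  \<comment> \<open>The Leibniz rule asks for a convex parameter set without singularities; the
    condition being open, a ball around \<open>p\<close> serves.\<close>
  have "open {p :: complex \<times> complex. 2 * norm (snd p) < norm (fst p)}"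
    by (intro open_Collect_less continuous_intros)
  then obtain e where "e > 0" and e: "ball p e \<subseteq> {p. 2 * norm (snd p) < norm (fst p)}"
    using assms unfolding open_contains_ball by blast
  then have near: "2 * norm (snd x) < norm (fst x)" if "x \<in> ball p e" for x
    using that by blast
  have "((\<lambda>p. integral (cbox 0 (2 * pi)) (\<lambda>\<theta>. inverse (norm (fst p - 2 * cis \<theta> * snd p) ^ n)))
    has_derivative integral (cbox 0 (2 * pi)) (circle_integrand_deriv n p)) (at p within ball p e)"
  proof (rule leibniz_rule)
    show "((\<lambda>p. inverse (norm (fst p - 2 * cis \<theta> * snd p) ^ n)) has_derivative
        blinfun_apply (circle_integrand_deriv n x \<theta>)) (at x within ball p e)" if "x \<in> ball p e" for x \<theta>
      by (rule circle_integrand_has_derivative[OF near[OF that]])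
    show "(\<lambda>\<theta>. inverse (norm (fst x - 2 * cis \<theta> * snd x) ^ n)) integrable_on cbox 0 (2 * pi)"
      if "x \<in> ball p e" for x
      unfolding cbox_interval
      by (intro integrable_continuous_interval continuous_on_circle_integrand near that)
    show "continuous_on (ball p e \<times> cbox 0 (2 * pi)) (\<lambda>(p, \<theta>). circle_integrand_deriv n p \<theta>)"
      by (rule continuous_on_circle_integrand_deriv[OF near])
  qed (simp_all add: \<open>e > 0\<close>)
  then show ?thesis
    using \<open>e > 0\<close> by (simp add: circle_integral_deriv_def circle_integral_def at_within_open[of _ "ball p e"])
qed

lemma continuous_on_circle_integral_deriv:
  assumes "\<And>p. p \<in> S \<Longrightarrow> 2 * norm (snd p) < norm (fst p)"
  shows "continuous_on S (circle_integral_deriv n)"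
  using integral_continuous_on_param[OF continuous_on_circle_integrand_deriv[OF assms, of S "cbox 0 (2 * pi)"]]
  by (simp add: circle_integral_deriv_def[abs_def])

section \<open>The boundary condition\<close>

text \<open>Cauchy-Schwarz and 2ab \<le> a^2 + b^2 bound the left side by the real part of
  \<open>kernel_C\<close>; strictness comes from its nonzero imaginary part t' - t.\<close>

lemma herm_lt_kernel_C:
  assumes "snd \<alpha> \<noteq> snd (\<beta> :: 'n::finite heis)"
  shows "2 * norm (herm (fst \<alpha>) (fst \<beta>)) < norm (kernel_C \<beta> \<alpha>)"
proof -
  have "2 * norm (herm (fst \<alpha>) (fst \<beta>)) \<le> 2 * (norm (fst \<alpha>) * norm (fst \<beta>))"
    using norm_herm_le by simp
  also have "\<dots> \<le> Re (kernel_C \<beta> \<alpha>)"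
    using sum_squares_bound[of "norm (fst \<alpha>)" "norm (fst \<beta>)"] by (simp add: kernel_C_def)
  also have "\<dots> \<le> \<bar>Re (kernel_C \<beta> \<alpha>)\<bar>" by simp
  also have "\<dots> < norm (kernel_C \<beta> \<alpha>)"
    using assms by (simp add: cmod_def kernel_C_def real_less_rsqrt)
  finally show ?thesis .
qed

lemma circ_average_g_kernel:
  assumes "snd \<alpha> \<noteq> snd (\<beta> :: 'n::finite heis)"
  shows "circ_average (g_kernel a \<beta>) \<alpha> =
    a / (2 * pi) * circle_integral CARD('n) (kernel_C \<beta> \<alpha>) (herm (fst \<alpha>) (fst \<beta>))"
proof -
  let ?f = "\<lambda>\<theta>. inverse (norm (kernel_C \<beta> \<alpha> - 2 * cis \<theta> * herm (fst \<alpha>) (fst \<beta>)) ^ CARD('n))"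
  have g: "g_kernel a \<beta> (rot \<theta> \<alpha>) = a * ?f \<theta>" for \<theta>
    by (simp add: g_kernel_def kernel_C_def kernel_Q_def rot_def herm_smult_left divide_inverse mult.assoc)
  \<comment> \<open>Off the level of the pole the integrand is continuous, so the Lebesgue integral
    in the average agrees with the Henstock-Kurzweil integral in
    \<open>circle_integral\<close>.\<close>
  have "continuous_on {0..2 * pi} ?f"
    by (intro continuous_intros continuous_on_circle_integrand herm_lt_kernel_C assms)
  then have "set_integrable lborel {0..2 * pi} ?f"
    by (rule borel_integrable_atLeastAtMost')
  then show ?thesis
    by (simp add: circ_average_rot g set_borel_integral_eq_integral(2) circle_integral_def)
qed

lemma circ_average_g_kernel_rot:
  assumes "snd \<alpha> \<noteq> snd (\<beta> :: 'n::finite heis)"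
  shows "circ_average (g_kernel a \<beta>) (rot \<theta> \<alpha>) = circ_average (g_kernel a \<beta>) \<alpha>"
proof -
  let ?w = "herm (fst \<alpha>) (fst \<beta>)" and ?A = "kernel_C \<beta> \<alpha>"
  have "circle_integral n ?A (cis \<theta> * ?w) = circle_integral n ?A ?w" for n
    using circle_integral_phase[of "cis \<theta> * ?w" ?A n] circle_integral_phase[of ?w ?A n]
      herm_lt_kernel_C[OF assms] by (simp add: norm_mult)
  moreover have "kernel_C \<beta> (rot \<theta> \<alpha>) = ?A" "herm (fst (rot \<theta> \<alpha>)) (fst \<beta>) = cis \<theta> * ?w"
    by (simp_all add: kernel_C_def rot_def herm_smult_left)
  moreover have "snd (rot \<theta> \<alpha>) \<noteq> snd \<beta>" using assms by (simp add: rot_def)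
  ultimately show ?thesis using assms by (simp add: circ_average_g_kernel)
qed

text \<open>Reflecting both points changes the sign of t' - t, which conjugates
  \<open>kernel_C\<close> and leaves the Hermitian product alone.\<close>

lemma circ_average_g_kernel_reflect:
  assumes "snd \<alpha> \<noteq> snd (\<beta> :: 'n::finite heis)"
  shows "circ_average (g_kernel a (reflect \<beta>)) (reflect \<alpha>) = circ_average (g_kernel a \<beta>) \<alpha>"
proof -
  have "kernel_C (reflect \<beta>) (reflect \<alpha>) = cnj (kernel_C \<beta> \<alpha>)"
    by (simp add: kernel_C_def reflect_def complex_eq_iff)
  moreover have "snd (reflect \<alpha>) \<noteq> snd (reflect \<beta>)" using assms by (simp add: reflect_def)
  ultimately show ?thesis
    using assms by (simp add: circ_average_g_kernel circle_integral_cnj herm_lt_kernel_C)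
      (simp add: reflect_def circle_integral_cnj herm_lt_kernel_C)
qed

section \<open>Derivative of the averaged kernel in the variable of the group\<close>

definition kernel_pair :: "'n::finite heis \<Rightarrow> 'n heis \<Rightarrow> complex \<times> complex" where
  "kernel_pair \<beta> \<alpha> = (kernel_C \<beta> \<alpha>, herm (fst \<alpha>) (fst \<beta>))"

lemma kernel_pair_has_derivative:
  "(kernel_pair (\<beta> :: 'n::finite heis) has_derivative
    (\<lambda>h. (of_real (2 * inner (fst \<alpha>) (fst h)) - \<i> * of_real (snd h), herm (fst h) (fst \<beta>)))) (at \<alpha>)"
proof -
  have herm: "((\<lambda>\<alpha>. herm (fst \<alpha>) (fst \<beta>)) has_derivative (\<lambda>h. herm (fst h) (fst \<beta>))) (at \<alpha>)"
    using linear_herm[of "fst \<beta>"]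
    by (intro bounded_linear.has_derivative[of "\<lambda>\<zeta>. herm \<zeta> (fst \<beta>)"])
       (auto simp: linear_conv_bounded_linear intro!: derivative_eq_intros)
  have C: "(kernel_C \<beta> has_derivative (\<lambda>h. of_real (2 * inner (fst \<alpha>) (fst h)) - \<i> * of_real (snd h))) (at \<alpha>)"
    unfolding kernel_C_def[abs_def] power2_norm_eq_inner
    by (auto intro!: derivative_eq_intros simp: inner_commute)
  show ?thesis
    unfolding kernel_pair_def[abs_def] by (intro has_derivative_Pair C herm)
qed

definition circ_kernel_deriv :: "real \<Rightarrow> 'n::finite heis \<Rightarrow> 'n heis \<Rightarrow> 'n heis \<Rightarrow> real" where
  "circ_kernel_deriv a \<beta> \<alpha> h = a / (2 * pi) * circle_integral_deriv CARD('n) (kernel_pair \<beta> \<alpha>)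
     (of_real (2 * inner (fst \<alpha>) (fst h)) - \<i> * of_real (snd h), herm (fst h) (fst \<beta>))"

lemma circ_average_g_kernel_has_derivative:
  assumes "snd \<alpha> \<noteq> snd (\<beta> :: 'n::finite heis)"
  shows "(circ_average (g_kernel a \<beta>) has_derivative circ_kernel_deriv a \<beta> \<alpha>) (at \<alpha>)"
proof -
  have "((\<lambda>p. circle_integral CARD('n) (fst p) (snd p)) has_derivative
      blinfun_apply (circle_integral_deriv CARD('n) (kernel_pair \<beta> \<alpha>))) (at (kernel_pair \<beta> \<alpha>))"
    using herm_lt_kernel_C[OF assms] by (intro circle_integral_has_derivative) (simp add: kernel_pair_def)
  from has_derivative_mult_right[OF has_derivative_compose[OF kernel_pair_has_derivative this]]
  have "((\<lambda>\<alpha>. a / (2 * pi) * circle_integral CARD('n) (fst (kernel_pair \<beta> \<alpha>)) (snd (kernel_pair \<beta> \<alpha>)))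
      has_derivative circ_kernel_deriv a \<beta> \<alpha>) (at \<alpha>)"
    unfolding circ_kernel_deriv_def[abs_def] .
  \<comment> \<open>The formula through \<open>circle_integral\<close> is known only off the level
    of the pole; that set is open, so the derivative carries over to the average itself.\<close>
  moreover have "open {\<alpha> :: 'n heis. snd \<alpha> \<noteq> snd \<beta>}"
    by (intro open_Collect_neq continuous_intros)
  ultimately show ?thesis
    by (rule has_derivative_transform_within_open)
       (use assms in \<open>simp_all add: circ_average_g_kernel kernel_pair_def\<close>)
qed

text \<open>In the vertical direction the vector fed to the linear map is the constant (-i, 0), so
  only the operator-valued derivative varies. This continuity gives the limit at characteristic
  points.\<close>

lemma isCont_circ_kernel_deriv_t:
  assumes "snd \<alpha> \<noteq> snd (\<beta> :: 'n::finite heis)"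
  shows "isCont (\<lambda>\<alpha>. circ_kernel_deriv a \<beta> \<alpha> (0, 1)) \<alpha>"
proof -
  have op: "open {p :: complex \<times> complex. 2 * norm (snd p) < norm (fst p)}"
    by (intro open_Collect_less continuous_intros)
  have "isCont (circle_integral_deriv CARD('n)) (kernel_pair \<beta> \<alpha>)"
    by (rule continuous_on_interior[OF continuous_on_circle_integral_deriv, 
          of "{p. 2 * norm (snd p) < norm (fst p)}"])
       (use herm_lt_kernel_C[OF assms] op in \<open>simp_all add: interior_open kernel_pair_def\<close>)
  moreover have "isCont (kernel_pair \<beta>) \<alpha>"
    by (rule has_derivative_continuous[OF kernel_pair_has_derivative])
  ultimately have "isCont (\<lambda>\<alpha>. circle_integral_deriv CARD('n) (kernel_pair \<beta> \<alpha>)) \<alpha>"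
    by (rule continuous_at_compose[unfolded o_def, rotated])
  then show ?thesis
    unfolding circ_kernel_deriv_def by (simp, intro continuous_intros) simp_all
qed

text \<open>In the sum of x_j Y_j - y_j X_j the horizontal parts assemble to the vector i \<zeta>,
  the velocity of the rotation, and the vertical parts to -2 times the sum of x_j^2 + y_j^2.\<close>

lemma normal_deriv_eq:
  fixes f :: "'n::finite heis \<Rightarrow> 'b::real_normed_vector"
  assumes f: "(f has_derivative f') (at \<alpha>)"
  shows "normal_deriv f \<alpha> = (1 / norm (fst \<alpha>)) *\<^sub>R
    (f' (\<i> *s fst \<alpha>, 0) - (2 * (norm (fst \<alpha>))\<^sup>2) *\<^sub>R f' (0, 1))"
proof -
  interpret f': bounded_linear f' by (rule has_derivative_bounded_linear[OF f])
  let ?x = "\<lambda>j. Re (fst \<alpha> $ j)" and ?y = "\<lambda>j. Im (fst \<alpha> $ j)"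
  have "\<i> *s fst \<alpha> = (\<Sum>j\<in>UNIV. ?x j *\<^sub>R axis j \<i> - ?y j *\<^sub>R axis j 1)"
    by (auto simp: vec_eq_iff axis_def if_distrib complex_eq_iff cong: if_cong)
  then have "(\<i> *s fst \<alpha>, 0) = (\<Sum>j\<in>UNIV. ?x j *\<^sub>R (axis j \<i>, 0) - ?y j *\<^sub>R (axis j 1, 0 :: real))"
    by (simp add: prod_eq_iff fst_sum snd_sum)
  then have rot': "f' (\<i> *s fst \<alpha>, 0) = (\<Sum>j\<in>UNIV. ?x j *\<^sub>R f' (axis j \<i>, 0) - ?y j *\<^sub>R f' (axis j 1, 0))"
    by (simp only: f'.sum f'.diff f'.scaleR)
  have norm': "(norm (fst \<alpha>))\<^sup>2 = (\<Sum>j\<in>UNIV. (?x j)\<^sup>2 + (?y j)\<^sup>2)"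
    by (simp add: norm_vec_def L2_set_def sum_nonneg cmod_power2)
  have "(\<Sum>j\<in>UNIV. ?x j *\<^sub>R vf_Y j f \<alpha> - ?y j *\<^sub>R vf_X j f \<alpha>) =
      (\<Sum>j\<in>UNIV. (?x j *\<^sub>R f' (axis j \<i>, 0) - ?y j *\<^sub>R f' (axis j 1, 0)) - (2 * ((?x j)\<^sup>2 + (?y j)\<^sup>2)) *\<^sub>R f' (0, 1))"
    by (rule sum.cong) (simp_all add: vf_X_def vf_Y_def dir_deriv_eq[OF f] algebra_simps power2_eq_square)
  also have "\<dots> = f' (\<i> *s fst \<alpha>, 0) - (2 * (norm (fst \<alpha>))\<^sup>2) *\<^sub>R f' (0, 1)"
    by (simp only: sum_subtractf rot' norm' scaleR_sum_left[symmetric] sum_distrib_left[symmetric])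
  finally show ?thesis by (simp add: normal_deriv_def)
qed

text \<open>The vector (i \<zeta>, 0) is the velocity at angle 0 of the orbit of
  \<open>\<alpha>\<close>, along which \<open>f\<close> is constant.\<close>

lemma rot_invariant_deriv_eq_0:
  fixes f :: "'n::finite heis \<Rightarrow> 'b::real_normed_vector"
  assumes f: "(f has_derivative f') (at \<alpha>)" and inv: "\<And>\<theta>. f (rot \<theta> \<alpha>) = f \<alpha>"
  shows "f' (\<i> *s fst \<alpha>, 0) = 0"
proof -
  have "rot \<theta> \<alpha> = (cos \<theta> *\<^sub>R fst \<alpha> + sin \<theta> *\<^sub>R (\<i> *s fst \<alpha>), snd \<alpha>)" for \<theta>
    by (simp add: rot_def vec_eq_iff complex_eq_iff)
  then have "((\<lambda>\<theta>. rot \<theta> \<alpha>) has_derivative (\<lambda>h. (h *\<^sub>R (\<i> *s fst \<alpha>), 0))) (at 0)"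
    by (auto intro!: derivative_eq_intros)
  moreover have "rot 0 \<alpha> = \<alpha>" by (simp add: rot_def)
  ultimately have "((\<lambda>\<theta>. f (rot \<theta> \<alpha>)) has_derivative (\<lambda>h. f' (h *\<^sub>R (\<i> *s fst \<alpha>), 0))) (at 0)"
    using f by (intro has_derivative_compose[of "\<lambda>\<theta>. rot \<theta> \<alpha>" _ 0 UNIV f f']) auto
  then have "(\<lambda>h. f' (h *\<^sub>R (\<i> *s fst \<alpha>), 0)) = (\<lambda>h::real. 0)"
    using has_derivative_unique[OF _ has_derivative_const[of "f \<alpha>" "at (0::real)"]] by (simp add: inv)
  from fun_cong[OF this, of 1] show ?thesis by simp
qed

text \<open>Evenness makes \<open>f' (0, h)\<close> and \<open>f' (0, - h)\<close> two derivatives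
  of the same function of t at 0, so they agree by uniqueness.\<close>

lemma reflect_invariant_deriv_eq_0:
  fixes f :: "'n::finite heis \<Rightarrow> 'b::real_normed_vector"
  assumes f: "(f has_derivative f') (at (\<zeta>, 0))"
    and "e > 0" and even: "\<And>t. \<bar>t\<bar> < e \<Longrightarrow> f (\<zeta>, - t) = f (\<zeta>, t)"
  shows "f' (0, 1) = 0"
proof -
  interpret f': bounded_linear f' by (rule has_derivative_bounded_linear[OF f])
  have pos: "((\<lambda>t. f (\<zeta>, t)) has_derivative (\<lambda>h. f' (0, h))) (at 0)"
    by (rule has_derivative_compose[of "\<lambda>t. (\<zeta>, t)" "\<lambda>h. (0, h)" 0 UNIV f f'])
       (use f in \<open>auto intro!: derivative_eq_intros\<close>)
  have "((\<lambda>t. f (\<zeta>, - t)) has_derivative (\<lambda>h. f' (0, - h))) (at 0)"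
    by (rule has_derivative_compose[of "\<lambda>t. (\<zeta>, - t)" "\<lambda>h. (0, - h)" 0 UNIV f f'])
       (use f in \<open>auto intro!: derivative_eq_intros\<close>)
  then have "((\<lambda>t. f (\<zeta>, t)) has_derivative (\<lambda>h. f' (0, - h))) (at 0)"
    by (rule has_derivative_transform_within_open[of _ _ _ _ "{- e<..<e}"])
       (use \<open>e > 0\<close> even in auto)
  from fun_cong[OF has_derivative_unique[OF pos this], of 1]
  have "f' (0, 1) = - f' (0, 1)"
    using f'.neg[of "(0, 1)"] by simp
  then have "2 *\<^sub>R f' (0, 1) = 0"
    by (simp only: eq_neg_iff_add_eq_0 scaleR_2)
  then show ?thesis by simp
qed

lemma neumann_G_perp_deriv:
  fixes \<beta> :: "'n::finite heis"
  assumes \<beta>: "\<beta> \<in> half_space" and \<alpha>: "\<alpha> \<in> frontier half_space"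
  shows "has_perp_deriv (neumann_G a \<beta>) 0 \<alpha>"
proof -
  \<comment> \<open>The strip is a neighbourhood of the boundary that avoids the levels t' and -t'
    of both poles, so every formula for the averaged kernels holds on it.\<close>
  define strip where "strip = {\<alpha> :: 'n heis. \<bar>snd \<alpha>\<bar> < snd \<beta>}"
  have "open strip" unfolding strip_def by (intro open_Collect_less continuous_intros)
  have off: "snd \<alpha> \<noteq> snd \<beta>" "snd \<alpha> \<noteq> snd (reflect \<beta>)" if "\<alpha> \<in> strip" for \<alpha>
    using that by (auto simp: strip_def reflect_def)
  let ?G = "neumann_G a \<beta>"
  define D where "D = (\<lambda>\<alpha> h. circ_kernel_deriv a \<beta> \<alpha> h + circ_kernel_deriv a (reflect \<beta>) \<alpha> h)"
  have deriv: "(?G has_derivative D \<alpha>) (at \<alpha>)" if "\<alpha> \<in> strip" for \<alpha>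
    unfolding neumann_G_def[abs_def] D_def
    by (intro has_derivative_add circ_average_g_kernel_has_derivative off that)
  have "D \<alpha> (\<i> *s fst \<alpha>, 0) = 0" if "\<alpha> \<in> strip" for \<alpha>
    by (rule rot_invariant_deriv_eq_0[OF deriv[OF that]])
       (simp add: neumann_G_def circ_average_g_kernel_rot off that)
  \<comment> \<open>One factor |\<zeta>| cancels against the normalization; where \<zeta> = 0 both
    sides are 0, as 1/0 = 0.\<close>
  then have normal: "normal_deriv ?G \<alpha> = - (2 * norm (fst \<alpha>)) * D \<alpha> (0, 1)" if "\<alpha> \<in> strip" for \<alpha>
    using that by (simp add: normal_deriv_eq[OF deriv] power2_eq_square)
  have snd_\<alpha>: "snd \<alpha> = 0"
    using \<alpha> frontier_halfspace_gt[of "(0, 1) :: 'n heis" 0]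
    by (auto simp: half_space_def inner_prod_def zero_prod_def)
  then have strip: "\<alpha> \<in> strip" using \<beta> by (simp add: strip_def half_space_def)
  show ?thesis
  proof (cases "fst \<alpha> = 0")
    case False
    \<comment> \<open>Reflection exchanges the two poles, hence the two summands of
      \<open>neumann_G\<close>.\<close>
    have even: "?G (fst \<alpha>, - t) = ?G (fst \<alpha>, t)" if "\<bar>t\<bar> < snd \<beta>" for t
    proof -
      have t: "t \<noteq> snd \<beta>" "t \<noteq> snd (reflect \<beta>)" using that by (auto simp: reflect_def)
      have "reflect (fst \<alpha>, t) = (fst \<alpha>, - t)" "reflect (reflect \<beta>) = \<beta>"
        by (simp_all add: reflect_def)
      then show ?thesis
        using circ_average_g_kernel_reflect[of "(fst \<alpha>, t)" \<beta> a]
          circ_average_g_kernel_reflect[of "(fst \<alpha>, t)" "reflect \<beta>" a] t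
        by (simp add: neumann_G_def)
    qed
    have "(?G has_derivative D \<alpha>) (at (fst \<alpha>, 0))"
      using deriv[OF strip] by (simp flip: snd_\<alpha>)
    then have "D \<alpha> (0, 1) = 0"
      by (rule reflect_invariant_deriv_eq_0[of _ _ _ "snd \<beta>"])
         (use \<beta> even in \<open>auto simp: half_space_def\<close>)
    then have "normal_deriv ?G \<alpha> = 0" by (simp add: normal[OF strip])
    with deriv[OF strip] False show ?thesis
      by (auto simp: has_perp_deriv_def differentiable_def)
  next
    case True
    define F where "F = at \<alpha> within {\<alpha>' \<in> closure half_space. fst \<alpha>' \<noteq> 0}"
    have ev: "\<forall>\<^sub>F \<alpha>' in F. \<alpha>' \<in> strip"
      using \<open>open strip\<close> strip unfolding F_def eventually_at_topological by auto
    have "isCont (\<lambda>\<alpha>. D \<alpha> (0, 1)) \<alpha>"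
      unfolding D_def by (intro continuous_intros isCont_circ_kernel_deriv_t off strip)
    then have "isCont (\<lambda>\<alpha>. - (2 * norm (fst \<alpha>)) * D \<alpha> (0, 1)) \<alpha>"
      by (intro continuous_intros)
    \<comment> \<open>At a characteristic point the limit vanishes through the factor |\<zeta>|;
      continuity of the vertical derivative keeps the other factor under control.\<close>
    then have "((\<lambda>\<alpha>. - (2 * norm (fst \<alpha>)) * D \<alpha> (0, 1)) \<longlongrightarrow> 0) F"
      unfolding isCont_def F_def using True by (auto intro: tendsto_within_subset)
    then have "(normal_deriv ?G \<longlongrightarrow> 0) F"
      by (rule Lim_transform_eventually) (use ev in \<open>auto elim!: eventually_mono simp: normal\<close>)
    moreover have "\<forall>\<^sub>F \<alpha>' in F. ?G differentiable at \<alpha>'"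
      using ev by eventually_elim (use deriv in \<open>auto simp: differentiable_def\<close>)
    ultimately show ?thesis
      using True by (simp add: has_perp_deriv_def F_def Let_def)
  qed
qed

theorem lemma4p2:
  fixes a\<^sub>0 :: real and \<beta> :: "'n::finite heis"
  assumes "normalizing_constant TYPE('n) a\<^sub>0"
    and "\<beta> \<in> half_space"
  shows "Delta0_eq_delta half_space circular (neumann_G a\<^sub>0 \<beta>) \<beta> \<and>
    (\<forall>\<alpha> \<in> frontier half_space. has_perp_deriv (neumann_G a\<^sub>0 \<beta>) 0 \<alpha>)"
  using assms neumann_G_Delta0 neumann_G_perp_deriv by blast

end
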